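(* Let $n \ge 1$. For any permutation $w \in S_n$, $$\lambda_1(w) + \mathrm{run}(w) = n.$$
   Context: $S_n$ is the symmetric group on $\{1,\dots,n\}$; for $1\le i\le n-1$, $s_i$ is the adjacent transposition swapping $i$ and $i+1$. The Coxeter length $\ell(w)$ is the minimal $\ell$ such that $w=s_{i_1}\cdots s_{i_\ell}$; if $\ell=\ell(w)$, the word $i_1\cdots i_{\ell}$ is called a reduced word of $w$ (the identity has the empty reduced word). A run is a nonempty increasing or decreasing sequence of consecutive integers (e.g. $234$ and $432$ are runs, $245$ is not; a single letter is a run). $\mathrm{run}(w)$ is the fewest number of runs whose concatenation is a reduced word of $w$, the minimum being taken over all reduced words of $w$ (so it is $0$ for the identity). $\lambda_1(w)$ is the length of the first row of the common shape of the tableaux $(P(w),Q(w))$ associated with $w$ (written in one-line notation $w(1)\cdots w(n)$) by the Robinson–Schensted–Knuth (row insertion) correspondence. *)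

theory Defs
  imports "HOL-Combinatorics.Combinatorics"
begin

text \<open>
  The symmetric group on \<open>{1..n}\<close> is the set of functions \<open>w\<close> with \<open>w permutes {1..n}\<close>,
  multiplied by composition of functions. The parameter \<open>n\<close> is explicit below because it
  determines both the generators and the one-line notation.
\<close>

definition adj_transp :: "nat \<Rightarrow> nat \<Rightarrow> nat" where
  "adj_transp i = transpose i (Suc i)"

definition word_prod :: "nat list \<Rightarrow> nat \<Rightarrow> nat" where
  "word_prod is = foldr (\<lambda>i f. adj_transp i \<circ> f) is id"

definition is_word_of :: "nat \<Rightarrow> (nat \<Rightarrow> nat) \<Rightarrow> nat list \<Rightarrow> bool" where
  "is_word_of n w is \<longleftrightarrow> set is \<subseteq> {1..n - 1} \<and> w = word_prod is"

definition coxeter_length :: "nat \<Rightarrow> (nat \<Rightarrow> nat) \<Rightarrow> nat" where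
  "coxeter_length n w = (LEAST l. \<exists>is. is_word_of n w is \<and> length is = l)"

definition reduced_word :: "nat \<Rightarrow> (nat \<Rightarrow> nat) \<Rightarrow> nat list \<Rightarrow> bool" where
  "reduced_word n w is \<longleftrightarrow> is_word_of n w is \<and> length is = coxeter_length n w"

definition is_run :: "nat list \<Rightarrow> bool" where
  "is_run r \<longleftrightarrow> r \<noteq> [] \<and> (\<exists>a b. r = [a..<b] \<or> r = rev [a..<b])"

definition run :: "nat \<Rightarrow> (nat \<Rightarrow> nat) \<Rightarrow> nat" where
  "run n w = (LEAST k. \<exists>rs. length rs = k \<and> (\<forall>r\<in>set rs. is_run r) \<and> reduced_word n w (concat rs))"

text \<open>
  A tableau is the list of its rows, top row first. Inserting \<open>x\<close> into a row replaces the
  leftmost entry greater than \<open>x\<close>, which is bumped and returned as the second component;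
  if there is no such entry, \<open>x\<close> is appended and nothing is bumped.
\<close>

type_synonym tableau = "nat list list"

fun row_insert :: "nat \<Rightarrow> nat list \<Rightarrow> nat list \<times> nat option" where
  "row_insert x [] = ([x], None)"
| "row_insert x (y # ys) =
    (if x < y then (x # ys, Some y)
     else let (r, b) = row_insert x ys in (y # r, b))"

text \<open>The second component is the index, counted from 0, of the row that receives the new box.\<close>

fun tableau_insert :: "nat \<Rightarrow> tableau \<Rightarrow> tableau \<times> nat" where
  "tableau_insert x [] = ([[x]], 0)"
| "tableau_insert x (r # rs) =
    (case row_insert x r of
       (r', None) \<Rightarrow> (r' # rs, 0)
     | (r', Some y) \<Rightarrow> let (rs', k) = tableau_insert y rs in (r' # rs', Suc k))"

definition add_box :: "nat \<Rightarrow> nat \<Rightarrow> tableau \<Rightarrow> tableau" where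
  "add_box k i Q = (if k < length Q then Q[k := Q ! k @ [i]] else Q @ [[i]])"

definition rsk_step :: "(nat \<Rightarrow> nat) \<Rightarrow> tableau \<times> tableau \<Rightarrow> nat \<Rightarrow> tableau \<times> tableau" where
  "rsk_step w PQ i =
    (let (P', k) = tableau_insert (w i) (fst PQ) in (P', add_box k i (snd PQ)))"

definition rsk :: "nat \<Rightarrow> (nat \<Rightarrow> nat) \<Rightarrow> tableau \<times> tableau" where
  "rsk n w = foldl (rsk_step w) ([], []) [1..<Suc n]"

definition shape :: "tableau \<Rightarrow> nat list" where
  "shape T = map length T"

lemma length_row_insert:
  "length (fst (row_insert x r)) =
    (case snd (row_insert x r) of None \<Rightarrow> Suc (length r) | Some _ \<Rightarrow> length r)"
  by (induction r) (auto split: option.splits prod.splits)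

lemma shape_tableau_insert:
  "shape P = shape Q \<Longrightarrow>
    shape (fst (tableau_insert x P)) = shape (add_box (snd (tableau_insert x P)) i Q)"
proof (induction P arbitrary: x Q)
  case Nil
  then show ?case by (simp add: shape_def add_box_def)
next
  case (Cons r rs)
  then obtain q qs where Q: "Q = q # qs" "length q = length r" "shape rs = shape qs"
    by (auto simp: shape_def Cons_eq_map_conv)
  obtain r' b where ri: "row_insert x r = (r', b)" by fastforce
  show ?case
  proof (cases b)
    case None
    then show ?thesis
      using length_row_insert[of x r] ri Q by (simp add: shape_def add_box_def)
  next
    case (Some y)
    then show ?thesis
      using length_row_insert[of x r] ri Q Cons.IH[of qs y]
      by (auto simp: shape_def add_box_def split: prod.splits if_splits)
  qed
qed

lemma shape_rsk: "shape (fst (rsk n w)) = shape (snd (rsk n w))"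
proof -
  have "shape (fst PQ) = shape (snd PQ) \<Longrightarrow>
      shape (fst (foldl (rsk_step w) PQ is)) = shape (snd (foldl (rsk_step w) PQ is))" for PQ "is"
  proof (induction "is" arbitrary: PQ)
    case (Cons i js)
    have "shape (fst (rsk_step w PQ i)) = shape (snd (rsk_step w PQ i))"
      using shape_tableau_insert[OF Cons.prems, of "w i" i]
      by (cases "tableau_insert (w i) (fst PQ)") (simp add: rsk_step_def)
    then show ?case using Cons.IH by simp
  qed simp
  then show ?thesis by (simp add: rsk_def shape_def)
qed

text \<open>By \<open>shape_rsk\<close> it does not matter that the shape is read off the insertion tableau.\<close>

definition lambda1 :: "nat \<Rightarrow> (nat \<Rightarrow> nat) \<Rightarrow> nat" where
  "lambda1 n w = (case shape (fst (rsk n w)) of [] \<Rightarrow> 0 | l # _ \<Rightarrow> l)"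

end

theory Submission
  imports Defs
begin

text \<open>
  By Schensted's theorem the first row of the insertion tableau has as many entries as a longest
  increasing subsequence of \<open>w\<close>, so the claim is that the longest increasing subsequences have
  \<open>n - run n w\<close> terms. Subsequences are represented by sets \<open>I\<close> of positions on which \<open>w\<close> is
  strictly increasing.

  A run multiplies out to a cycle that shifts an interval by one place and sends one end of it to
  the other, so it preserves the order of all points but one. Multiplying by a run therefore
  destroys at most one term of an increasing subsequence, and a product of \<open>k\<close> runs keeps an
  increasing subsequence with at least \<open>n - k\<close> terms (\<open>increasing_set_of_run_product\<close>).

  For the other inequality, let \<open>w\<close> increase on \<open>I\<close>. If some position outside \<open>I\<close> forms no
  inversion with a position in \<open>I\<close>, it can be added to \<open>I\<close> for free. Otherwise some value outside
  the subsequence lies to the right of a larger term or to the left of a smaller one. In the first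
  case, the smallest such value can be moved left, past larger values only, to a place where it
  extends the subsequence (\<open>increasing_set_move_left\<close>). This is multiplication by one run, and
  every adjacent transposition in it removes an inversion, so no length is wasted. The second case
  is the first one for the inverse permutation, whose reduced words are the reversed ones. After at
  most \<open>n - card I\<close> moves the identity is reached (\<open>ex_reduced_run_factorization\<close>). The word
  collected on the way has as many letters as \<open>w\<close> has inversions, and a letter changes the number
  of inversions by one, so the word is reduced.
\<close>

section \<open>Products of words and runs\<close>

lemma word_prod_Nil [simp]: "word_prod [] = id"
  by (simp add: word_prod_def)

lemma word_prod_Cons: "word_prod (k # ks) = adj_transp k \<circ> word_prod ks"
  by (simp add: word_prod_def)

lemma word_prod_append: "word_prod (xs @ ys) = word_prod xs \<circ> word_prod ys"
  by (induction xs) (simp_all add: word_prod_Cons o_assoc)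

lemma adj_transp_invol [simp]: "adj_transp k (adj_transp k i) = i"
  by (simp add: adj_transp_def)

lemma bij_word_prod: "bij (word_prod ks)"
proof (induction ks)
  case (Cons k ks)
  then show ?case unfolding word_prod_Cons adj_transp_def by (intro bij_comp bij_transpose)
qed (simp only: word_prod_Nil bij_id)

lemma word_prod_rev_cancel: "word_prod (rev ks) (word_prod ks x) = x"
  by (induction ks) (simp_all add: word_prod_append word_prod_Cons)

lemma word_prod_rev: "word_prod (rev ks) = inv (word_prod ks)"
  using word_prod_rev_cancel[of ks] word_prod_rev_cancel[of "rev ks"]
  by (intro inv_unique_comp[symmetric]) (simp_all add: fun_eq_iff)

lemma word_prod_upt:
  "a \<le> b \<Longrightarrow> word_prod [a..<b] =
    (\<lambda>k. if a \<le> k \<and> k < b then Suc k else if k = b then a else k)"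
  by (induction b rule: dec_induct)
    (auto simp: word_prod_append word_prod_Cons adj_transp_def fun_eq_iff transpose_def)

lemma word_prod_rev_upt:
  "a \<le> b \<Longrightarrow> word_prod (rev [a..<b]) =
    (\<lambda>k. if a < k \<and> k \<le> b then k - 1 else if k = a then b else k)"
  by (induction b rule: dec_induct)
    (auto simp: word_prod_append word_prod_Cons adj_transp_def fun_eq_iff transpose_def)

lemma run_strict_mono_off_point:
  assumes "is_run r"
  shows "\<exists>p. strict_mono_on (- {p}) (word_prod r)"
proof -
  obtain a b where r: "r = [a..<b] \<or> r = rev [a..<b]" and "r \<noteq> []"
    using assms by (auto simp: is_run_def)
  then have "a < b" by (metis rev.simps(1) upt_conv_Nil not_less)
  then have "strict_mono_on (- {b}) (word_prod [a..<b])"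
    and "strict_mono_on (- {a}) (word_prod (rev [a..<b]))"
    by (auto simp: word_prod_upt word_prod_rev_upt monotone_on_def split: if_splits)
  with r show ?thesis by blast
qed

lemma is_run_rev: "is_run r \<Longrightarrow> is_run (rev r)"
  unfolding is_run_def by (metis rev_is_Nil_conv rev_rev_ident)

text \<open>
  Peel off the leftmost run. It acts on the values of the remaining product, and only the position
  carrying the one value whose order it disturbs has to be given up.
\<close>

lemma increasing_set_of_run_product:
  assumes "\<forall>r\<in>set rs. is_run r"
  shows "\<exists>I \<subseteq> {1..n}. strict_mono_on I (word_prod (concat rs)) \<and> n \<le> card I + length rs"
  using assms
proof (induction rs)
  case Nil
  then show ?case by (intro exI[of _ "{1..n}"]) (auto intro!: strict_mono_onI)
next
  case (Cons r rs)
  let ?f = "word_prod (concat rs)"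
  from Cons obtain I where I: "I \<subseteq> {1..n}" "strict_mono_on I ?f" "n \<le> card I + length rs"
    by auto
  from Cons.prems obtain p where p: "strict_mono_on (- {p}) (word_prod r)"
    using run_strict_mono_off_point by auto
  let ?q = "inv ?f p"
  have ne: "?f i \<noteq> p" if "i \<noteq> ?q" for i
    using that bij_word_prod[of "concat rs"] by (metis bij_inv_eq_iff)
  have "strict_mono_on (I - {?q}) (word_prod (concat (r # rs)))"
    using I(2) p ne by (auto simp: word_prod_append monotone_on_def)
  moreover have "card I \<le> Suc (card (I - {?q}))"
    using I(1) by (metis card_Diff1_le card_Suc_Diff1 card_Diff_singleton_if finite_atLeastAtMost
        finite_subset le_SucI order_refl Diff_empty Diff_insert0)
  ultimately show ?case
    using I by (intro exI[of _ "I - {?q}"]) auto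
qed

section \<open>Inversions and reduced words\<close>

definition inversion_set :: "nat \<Rightarrow> (nat \<Rightarrow> nat) \<Rightarrow> (nat \<times> nat) set" where
  "inversion_set n w = {(i, j). 1 \<le> i \<and> i < j \<and> j \<le> n \<and> w j < w i}"

lemma finite_inversion_set [simp]: "finite (inversion_set n w)"
  by (rule finite_subset[of _ "{1..n} \<times> {1..n}"]) (auto simp: inversion_set_def)

text \<open>
  Exchanging the entries at \<open>k\<close> and \<open>Suc k\<close> transports every inversion to an inversion,
  because \<open>(k, Suc k)\<close> is the only pair of positions whose order changes.
\<close>

lemma card_inversion_set_ascent:
  assumes "1 \<le> k" "k < n" "w k < w (Suc k)"
  shows "card (inversion_set n (w \<circ> adj_transp k)) = Suc (card (inversion_set n w))"
proof -
  let ?s = "adj_transp k"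
  let ?f = "map_prod ?s ?s"
  have inj: "inj ?f" by (simp add: adj_transp_def prod.inj_map)
  have "inversion_set n (w \<circ> ?s) = insert (k, Suc k) (?f ` inversion_set n w)"
  proof (intro set_eqI iffI)
    fix x assume x: "x \<in> inversion_set n (w \<circ> ?s)"
    show "x \<in> insert (k, Suc k) (?f ` inversion_set n w)"
    proof (cases "x = (k, Suc k)")
      case False
      then have "?f x \<in> inversion_set n w"
        using x assms by (auto simp: inversion_set_def adj_transp_def transpose_def split: if_splits)
      moreover have "x = ?f (?f x)" by (cases x) simp
      ultimately show ?thesis by blast
    qed simp
  next
    fix x assume "x \<in> insert (k, Suc k) (?f ` inversion_set n w)"
    then consider "x = (k, Suc k)"
      | i j where "x = (?s i, ?s j)" "1 \<le> i" "i < j" "j \<le> n" "w j < w i"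
      by (auto simp: inversion_set_def)
    then show "x \<in> inversion_set n (w \<circ> ?s)"
    proof cases
      case 1
      then show ?thesis using assms by (simp add: inversion_set_def adj_transp_def)
    next
      case 2
      have "(i, j) \<noteq> (k, Suc k)" using 2 assms by auto
      then have "?s i < ?s j" "1 \<le> ?s i" "?s j \<le> n"
        using 2 assms by (auto simp: adj_transp_def transpose_def)
      then show ?thesis using 2 by (simp add: inversion_set_def)
    qed
  qed
  moreover have "(k, Suc k) \<notin> ?f ` inversion_set n w"
    using assms by (auto simp: inversion_set_def adj_transp_def transpose_def split: if_splits)
  ultimately show ?thesis
    using inj by (simp add: card_image inj_on_subset)
qed

lemma card_inversion_set_descent:
  assumes "1 \<le> k" "k < n" "w (Suc k) < w k"
  shows "card (inversion_set n w) = Suc (card (inversion_set n (w \<circ> adj_transp k)))"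
  using card_inversion_set_ascent[of k n "w \<circ> adj_transp k"] assms
  by (simp add: o_assoc[symmetric]) (simp add: adj_transp_def)

lemma card_inversion_set_le_length:
  assumes "set ks \<subseteq> {1..n - 1}"
  shows "card (inversion_set n (word_prod ks)) \<le> length ks"
  using assms
proof (induction ks rule: rev_induct)
  case Nil
  have "inversion_set n (word_prod []) = {}" by (auto simp: inversion_set_def)
  then show ?case by (metis card.empty le0)
next
  case (snoc k ks)
  let ?w = "word_prod ks"
  have k: "1 \<le> k" "k < n" using snoc.prems by auto
  have "?w k \<noteq> ?w (Suc k)" using bij_word_prod[of ks] by (metis bij_pointE n_not_Suc_n)
  then consider "?w k < ?w (Suc k)" | "?w (Suc k) < ?w k" by linarith
  then have "card (inversion_set n (?w \<circ> adj_transp k)) \<le> Suc (card (inversion_set n ?w))"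
    using card_inversion_set_ascent[OF k, of ?w] card_inversion_set_descent[OF k, of ?w]
    by cases simp_all
  moreover have "word_prod (ks @ [k]) = ?w \<circ> adj_transp k"
    by (simp add: word_prod_append word_prod_Cons fun_eq_iff)
  moreover have "card (inversion_set n ?w) \<le> length ks" using snoc by simp
  ultimately have "card (inversion_set n (word_prod (ks @ [k]))) \<le> Suc (length ks)"
    by (metis Suc_le_mono le_trans)
  then show ?case by simp
qed

lemma reduced_wordI:
  assumes "is_word_of n w ks" "length ks = card (inversion_set n w)"
  shows "reduced_word n w ks"
proof -
  have "coxeter_length n w = length ks"
    unfolding coxeter_length_def
    using assms card_inversion_set_le_length
    by (intro Least_equality) (auto simp: is_word_of_def)
  then show ?thesis using assms by (simp add: reduced_word_def)
qed

lemma card_inversion_set_inv: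
  assumes "w permutes {1..n}"
  shows "card (inversion_set n (inv w)) = card (inversion_set n w)"
proof -
  have le: "card (inversion_set n v) \<le> card (inversion_set n (inv v))" if v: "v permutes {1..n}" for v
  proof (rule card_inj_on_le)
    show "inj_on (\<lambda>(i, j). (v j, v i)) (inversion_set n v)"
      using permutes_inj[OF v] by (auto simp: inj_on_def inj_def)
    show "(\<lambda>(i, j). (v j, v i)) ` inversion_set n v \<subseteq> inversion_set n (inv v)"
    proof clarify
      fix i j assume "(i, j) \<in> inversion_set n v"
      then show "(v j, v i) \<in> inversion_set n (inv v)"
        using permutes_in_image[OF v, of i] permutes_in_image[OF v, of j]
        by (auto simp: inversion_set_def permutes_inverses[OF v])
    qed
  qed simp
  show ?thesis
    using le[OF assms] le[OF permutes_inv[OF assms]] permutes_inv_inv[OF assms] by simp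
qed

text \<open>
  Right multiplication by \<open>word_prod (rev [a..<b])\<close> moves the entry at position \<open>b\<close> to position \<open>a\<close>
  one step at a time; if it passes larger entries only, each step is the exchange of a descent.
\<close>

lemma card_inversion_set_move_left:
  assumes "a \<le> b" "1 \<le> a" "b \<le> n" "\<forall>k\<in>{a..<b}. w b < w k"
  shows "card (inversion_set n w)
    = card (inversion_set n (w \<circ> word_prod (rev [a..<b]))) + (b - a)"
  using assms
proof (induction b arbitrary: w rule: dec_induct)
  case (step b)
  let ?w = "w \<circ> adj_transp b"
  have "\<forall>k\<in>{a..<b}. ?w b < ?w k"
    using step.prems by (auto simp: adj_transp_def transpose_def)
  then have "card (inversion_set n ?w)
      = card (inversion_set n (?w \<circ> word_prod (rev [a..<b]))) + (b - a)"
    using step.prems by (intro step.IH) auto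
  moreover have "card (inversion_set n w) = Suc (card (inversion_set n ?w))"
    using step by (intro card_inversion_set_descent) auto
  moreover have "w \<circ> word_prod (rev [a..<Suc b]) = ?w \<circ> word_prod (rev [a..<b])"
    using step.hyps by (simp add: word_prod_Cons fun_eq_iff)
  ultimately show ?case
    using step.hyps by (simp only: Suc_diff_le)
qed (simp add: inversion_set_def)

section \<open>Factoring a permutation into few runs\<close>

text \<open>
  Reducedness is expressed through the number of inversions, which can be followed step by step
  while a word is built.
\<close>

definition reduced_run_factorization :: "nat \<Rightarrow> (nat \<Rightarrow> nat) \<Rightarrow> nat list list \<Rightarrow> bool" where
  "reduced_run_factorization n w rs \<longleftrightarrow>
    (\<forall>r\<in>set rs. is_run r) \<and> is_word_of n w (concat rs) \<and>
    length (concat rs) = card (inversion_set n w)"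

lemma reduced_run_factorization_inv:
  assumes "reduced_run_factorization n (inv w) rs" "w permutes {1..n}"
  shows "reduced_run_factorization n w (map rev (rev rs))"
proof -
  have "concat (map rev (rev rs)) = rev (concat rs)"
    by (simp add: rev_concat rev_map)
  moreover have "w = word_prod (rev (concat rs))"
    using assms permutes_inv_inv[OF assms(2)]
    by (auto simp: reduced_run_factorization_def is_word_of_def word_prod_rev)
  ultimately show ?thesis
    using assms card_inversion_set_inv[OF assms(2)]
    by (auto simp: reduced_run_factorization_def is_word_of_def is_run_rev)
qed

lemma reduced_run_factorization_snoc:
  assumes "reduced_run_factorization n (w \<circ> word_prod (rev [a..<b])) rs"
    and "1 \<le> a" "a < b" "b \<le> n" "\<forall>k\<in>{a..<b}. w b < w k"
  shows "reduced_run_factorization n w (rs @ [[a..<b]])"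
proof -
  have "is_run [a..<b]" using assms by (auto simp: is_run_def)
  moreover have "w = word_prod (concat rs) \<circ> word_prod [a..<b]"
    using assms(1) word_prod_rev_cancel[of "[a..<b]"]
    by (simp add: reduced_run_factorization_def is_word_of_def fun_eq_iff)
       (metis word_prod_rev_cancel rev_rev_ident)
  ultimately show ?thesis
    using assms card_inversion_set_move_left[of a b n w]
    by (auto simp: reduced_run_factorization_def is_word_of_def word_prod_append)
qed

text \<open>
  The entry to move is the smallest value \<open>w b\<close> outside the increasing subsequence that has a
  larger term of it on its left, and \<open>a\<close> is the position of the leftmost larger term. An entry
  between \<open>a\<close> and \<open>b\<close> that is smaller than \<open>w b\<close> would come after \<open>w a\<close> and be smaller than \<open>w a\<close>;
  it could not belong to the subsequence, and it would contradict the minimality of \<open>w b\<close>. So only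
  larger entries are passed. At position \<open>a\<close> the moved value extends the subsequence: the terms
  before it are smaller by the choice of \<open>a\<close>, the terms from \<open>w a\<close> onwards are larger.
\<close>

lemma increasing_set_move_left:
  assumes w: "w permutes {1..n}" and I: "I \<subseteq> {1..n}" "strict_mono_on I w"
    and ex: "\<exists>x\<in>{1..n} - I. \<exists>y\<in>I. y < x \<and> w x < w y"
  shows "\<exists>a b J. 1 \<le> a \<and> a < b \<and> b \<le> n \<and> (\<forall>k\<in>{a..<b}. w b < w k) \<and>
    J \<subseteq> {1..n} \<and> card J = Suc (card I) \<and> strict_mono_on J (w \<circ> word_prod (rev [a..<b]))"
proof -
  have inj: "w i = w j \<Longrightarrow> i = j" for i j using permutes_inj[OF w] by (simp add: inj_def)
  define L where "L = {x\<in>{1..n} - I. \<exists>y\<in>I. y < x \<and> w x < w y}"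
  define b where "b = arg_min_on w L"
  have "finite L" "L \<noteq> {}" using ex by (auto simp: L_def)
  then have b: "b \<in> L" and bmin: "x \<in> L \<Longrightarrow> w b \<le> w x" for x
    unfolding b_def by (auto intro: arg_min_if_finite(1) arg_min_least)
  define a where "a = (LEAST y. y \<in> I \<and> w b < w y)"
  obtain y where y: "y \<in> I" "y < b" "w b < w y" using b by (auto simp: L_def)
  then have a: "a \<in> I" "w b < w a" unfolding a_def by (auto intro: LeastI2)
  have amin: "a \<le> i" if "i \<in> I" "w b < w i" for i
    using that unfolding a_def by (auto intro: Least_le)
  have ab: "a < b" using amin[of y] y by simp
  have bounds: "1 \<le> a" "b \<le> n" "b \<notin> I" using a b I by (auto simp: L_def)
  have above: "w b < w k" if k: "a \<le> k" "k < b" for k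
  proof (rule ccontr)
    assume "\<not> w b < w k"
    then have kb: "w k < w b" using inj[of k b] k by fastforce
    then have "a < k" using a k by (metis le_neq_implies_less less_asym)
    moreover have "k \<notin> I"
      using strict_mono_onD[OF I(2) a(1) _ \<open>a < k\<close>] kb a by auto
    ultimately have "k \<in> L" using a kb k bounds by (auto simp: L_def intro!: bexI[of _ a])
    with bmin kb show False by fastforce
  qed
  \<comment> \<open>\<open>?c\<close> sends an old position to its new one, \<open>?d\<close> is its inverse.\<close>
  let ?c = "word_prod [a..<b]" and ?d = "word_prod (rev [a..<b])"
  define J where "J = ?c ` insert b I"
  have c: "?c = (\<lambda>k. if a \<le> k \<and> k < b then Suc k else if k = b then a else k)"
    using word_prod_upt ab by simp
  have dc: "?d (?c k) = k" for k
    by (rule word_prod_rev_cancel)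
  have "J \<subseteq> {1..n}" using I bounds ab by (auto simp: J_def c)
  moreover have "card J = Suc (card I)"
  proof -
    have "inj ?c" using bij_word_prod bij_is_inj by blast
    then have "card J = card (insert b I)" unfolding J_def by (meson card_image inj_on_subset subset_UNIV)
    also have "\<dots> = Suc (card I)" using bounds finite_subset[OF I(1)] by simp
    finally show ?thesis .
  qed
  moreover have "strict_mono_on J (w \<circ> ?d)"
  proof (rule strict_mono_onI)
    fix r s assume "r \<in> J" "s \<in> J" "r < s"
    then obtain i j where ij: "i \<in> insert b I" "j \<in> insert b I" "r = ?c i" "s = ?c j"
      by (auto simp: J_def)
    have lt: "?c i < ?c j" using \<open>r < s\<close> ij by simp
    have "w i < w j"
    proof -
      consider "i = b" | "i \<noteq> b" "j = b" | "i \<noteq> b" "j \<noteq> b" by blast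
      then show ?thesis
      proof cases
        case 1
        with lt ij ab have "j \<in> I" "a \<le> j" by (auto simp: c split: if_splits)
        then have "w a \<le> w j" using I(2) a by (metis le_eq_less_or_eq strict_mono_onD)
        with 1 a show ?thesis by simp
      next
        case 2
        with lt ij ab have "i \<in> I" "i < a" by (auto simp: c split: if_splits)
        with amin[of i] inj[of i b] 2 show ?thesis by fastforce
      next
        case 3
        with lt have "i < j" by (auto simp: c split: if_splits)
        with 3 ij I(2) show ?thesis by (auto dest: strict_mono_onD)
      qed
    qed
    then show "(w \<circ> ?d) r < (w \<circ> ?d) s" by (simp add: ij dc)
  qed
  ultimately show ?thesis using ab bounds above by (intro exI[of _ a] exI[of _ b] exI[of _ J]) auto
qed

lemma permutes_strict_mono_on_eq_id:
  fixes w :: "nat \<Rightarrow> nat"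
  assumes "w permutes {1..n}" "strict_mono_on {1..n} w"
  shows "w = id"
proof (rule permutes_natset_ge[OF assms(1)], rule ballI)
  have "i \<le> n \<Longrightarrow> i \<le> w i" for i
  proof (induction i)
    case (Suc i)
    show ?case
    proof (cases "i = 0")
      case True
      then show ?thesis using permutes_in_image[OF assms(1), of 1] Suc by auto
    next
      case False
      then have "w i < w (Suc i)" using Suc assms(2) by (auto intro: strict_mono_onD)
      then show ?thesis using Suc by simp
    qed
  qed simp
  then show "i \<le> w i" if "i \<in> {1..n}" for i using that by simp
qed

text \<open>
  Each induction step on \<open>n - card I\<close> enlarges \<open>I\<close>, either by moving an entry, at the cost of one
  run, or by adding a position that was already in order with \<open>I\<close>, at no cost. The inequality
  instead of \<open>length rs + card I = n\<close> absorbs the free steps, so that the step works for every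
  increasing \<open>I\<close> and not just for one of maximal size.
\<close>

lemma ex_reduced_run_factorization:
  assumes "w permutes {1..n}" "I \<subseteq> {1..n}" "strict_mono_on I w"
  shows "\<exists>rs. reduced_run_factorization n w rs \<and> length rs + card I \<le> n"
  using assms
proof (induction "n - card I" arbitrary: w I rule: less_induct)
  case less
  note w = less.prems(1) and I = less.prems(2,3)
  have fin: "finite I" using I finite_subset by blast
  have Ile: "card I < n" if "I \<noteq> {1..n}"
    using that I psubset_card_mono[of "{1..n}" I] by auto
  have factor: "\<exists>rs. reduced_run_factorization n v rs \<and> length rs + card K \<le> n"
    if v: "v permutes {1..n}" and K: "K \<subseteq> {1..n}" "strict_mono_on K v" "card K = card I"
      and ex: "\<exists>x\<in>{1..n} - K. \<exists>y\<in>K. y < x \<and> v x < v y" for v K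
  proof -
    obtain a b J where ab: "1 \<le> a" "a < b" "b \<le> n" "\<forall>k\<in>{a..<b}. v b < v k"
      and J: "J \<subseteq> {1..n}" "card J = Suc (card K)" "strict_mono_on J (v \<circ> word_prod (rev [a..<b]))"
      using increasing_set_move_left[OF v K(1,2) ex] by blast
    have "word_prod (rev [a..<b]) permutes {1..n}"
      using ab bij_word_prod[of "rev [a..<b]"]
      by (auto simp: permutes_def bij_iff word_prod_rev_upt)
    then have "v \<circ> word_prod (rev [a..<b]) permutes {1..n}"
      using v permutes_compose by blast
    moreover have "card J \<le> n" using J(1) card_mono[of "{1..n}" J] by simp
    moreover from this have "n - card J < n - card I" using J(2) K(3) by simp
    ultimately obtain rs where "reduced_run_factorization n (v \<circ> word_prod (rev [a..<b])) rs"
      "length rs + card J \<le> n"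
      using less.hyps[OF _ _ J(1,3)] by blast
    then show ?thesis
      using reduced_run_factorization_snoc[OF _ ab] J(2)
      by (intro exI[of _ "rs @ [[a..<b]]"]) auto
  qed
  define A where "A = {1..n} - I"
  have "I = {1..n} \<or> (\<exists>x. x \<in> A)" using I(1) unfolding A_def by blast
  then consider (full) "I = {1..n}"
    | (left) "\<exists>x\<in>A. \<exists>y\<in>I. y < x \<and> w x < w y"
    | (right) "\<exists>x\<in>A. \<exists>y\<in>I. x < y \<and> w y < w x"
    | (comparable) x where "x \<in> A"
      "\<And>y. y \<in> I \<Longrightarrow> \<not> (y < x \<and> w x < w y) \<and> \<not> (x < y \<and> w y < w x)"
    by blast
  then show ?case
  proof cases
    case full
    then have "w = id" using permutes_strict_mono_on_eq_id w I by blast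
    moreover have "inversion_set n id = {}" by (auto simp: inversion_set_def)
    ultimately have "reduced_run_factorization n w []"
      by (simp add: reduced_run_factorization_def is_word_of_def)
    then show ?thesis using full by (intro exI[of _ "[]"]) simp
  next
    case left
    note left = left[unfolded A_def]
    then show ?thesis using factor[OF w I refl left] by simp
  next
    case right
    note right = right[unfolded A_def]
    \<comment> \<open>Inversion reflects the graph of \<open>w\<close> in the diagonal, so it swaps "larger and to the left"
      with "smaller and to the right".\<close>
    let ?v = "inv w" and ?K = "w ` I"
    have vw: "?v (w i) = i" for i using permutes_inverses[OF w] by simp
    have inj: "inj w" using permutes_inj[OF w] .
    have "?K \<subseteq> {1..n}" using I permutes_image[OF w] by blast
    moreover have "strict_mono_on ?K ?v"
    proof (rule strict_mono_onI)
      fix r s assume "r \<in> ?K" "s \<in> ?K" "r < s"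
      then obtain i j where "i \<in> I" "j \<in> I" "r = w i" "s = w j" by blast
      with \<open>r < s\<close> show "?v r < ?v s"
        using I(2) strict_mono_onD[of I w j i] by (cases i j rule: linorder_cases) (auto simp: vw)
    qed
    moreover have "card ?K = card I" using inj by (simp add: card_image inj_on_subset)
    moreover have "\<exists>x\<in>{1..n} - ?K. \<exists>y\<in>?K. y < x \<and> ?v x < ?v y"
    proof -
      obtain x y where xy: "x \<in> {1..n} - I" "y \<in> I" "x < y" "w y < w x" using right by blast
      then have "w x \<in> {1..n} - ?K"
        using permutes_in_image[OF w] inj by (auto simp: inj_def)
      with xy show ?thesis by (intro bexI[of _ "w x"] bexI[of _ "w y"]) (auto simp: vw)
    qed
    ultimately obtain rs where "reduced_run_factorization n ?v rs" "length rs + card ?K \<le> n"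
      using factor[OF permutes_inv[OF w]] by metis
    then show ?thesis
      using reduced_run_factorization_inv[OF _ w] \<open>card ?K = card I\<close>
      by (intro exI[of _ "map rev (rev rs)"]) auto
  next
    case comparable
    note comparable = comparable[unfolded A_def]
    have ne: "w x \<noteq> w y" if "y \<in> I" for y
      using that comparable(1) permutes_inj[OF w] by (auto simp: inj_def)
    have "strict_mono_on (insert x I) w"
    proof (rule strict_mono_onI)
      fix r s assume "r \<in> insert x I" "s \<in> insert x I" "r < s"
      then show "w r < w s"
        using comparable(2)[of r] comparable(2)[of s] ne[of r] ne[of s] strict_mono_onD[OF I(2), of r s]
        by (metis insertE linorder_neqE_nat less_irrefl)
    qed
    moreover have "card (insert x I) = Suc (card I)" using comparable fin by simp
    moreover have "card I < n" using comparable Ile by blast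
    ultimately have "\<exists>rs. reduced_run_factorization n w rs \<and> length rs + Suc (card I) \<le> n"
      using less.hyps[of "insert x I" w] w I comparable(1) by auto
    then show ?thesis by auto
  qed
qed

section \<open>The first row and increasing subsequences\<close>

definition first_row :: "tableau \<Rightarrow> nat list" where
  "first_row T = (case T of [] \<Rightarrow> [] | r # _ \<Rightarrow> r)"

lemma first_row_tableau_insert:
  "first_row (fst (tableau_insert x T)) = fst (row_insert x (first_row T))"
  by (cases T) (auto simp: first_row_def split: prod.splits option.splits)

lemma first_row_rsk_Suc:
  "first_row (fst (rsk (Suc m) w)) = fst (row_insert (w (Suc m)) (first_row (fst (rsk m w))))"
proof -
  have "rsk (Suc m) w = rsk_step w (rsk m w) (Suc m)" by (simp add: rsk_def)
  then show ?thesis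
    by (simp add: rsk_step_def case_prod_unfold Let_def first_row_tableau_insert)
qed

lemma set_row_insert: "set (fst (row_insert x r)) \<subseteq> insert x (set r)"
  by (induction r) (auto split: prod.splits)

lemma sorted_row_insert: "sorted r \<Longrightarrow> sorted (fst (row_insert x r))"
proof (induction r)
  case (Cons y ys)
  then show ?case using set_row_insert[of x ys] by (auto simp: case_prod_unfold Let_def)
qed simp

lemma sorted_first_row_rsk: "sorted (first_row (fst (rsk m w)))"
proof (induction m)
  case 0
  then show ?case by (simp add: rsk_def first_row_def)
next
  case (Suc m)
  then show ?case by (simp only: first_row_rsk_Suc sorted_row_insert)
qed

abbreviation count_le :: "nat \<Rightarrow> nat list \<Rightarrow> nat" where
  "count_le v r \<equiv> length (filter (\<lambda>y. y \<le> v) r)"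

text \<open>
  The number of entries up to \<open>v\<close> obeys the recursion of the maximal size of an increasing
  subsequence with values up to \<open>v\<close> when \<open>x\<close> is appended: a new subsequence through \<open>x\<close> extends one
  with values up to \<open>x\<close>. In the row, \<open>x\<close> replaces the first entry greater than \<open>x\<close>, if any, so
  the count grows exactly for those \<open>v \<ge> x\<close> that are smaller than the replaced entry.
\<close>

lemma count_le_row_insert:
  assumes "sorted r"
  shows "count_le v (fst (row_insert x r)) =
    (if x \<le> v then max (count_le v r) (Suc (count_le x r)) else count_le v r)"
  using assms
proof (induction r)
  case (Cons y ys)
  have "count_le u ys = 0" if "u < y" for u
    using that Cons.prems by (auto simp: filter_empty_conv)
  then show ?case using Cons by (auto simp: case_prod_unfold Let_def)
qed simp

text \<open>
  Schensted's theorem, refined by a bound on the values: the bound is what makes the induction over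
  the inserted entries work, since a subsequence ending in \<open>w (Suc m)\<close> is controlled by the bound
  \<open>w (Suc m)\<close> on the others.
\<close>

lemma count_le_first_row_rsk:
  assumes "inj w"
  shows "(\<exists>I \<subseteq> {1..m}. strict_mono_on I w \<and> (\<forall>i\<in>I. w i \<le> v) \<and>
      card I = count_le v (first_row (fst (rsk m w)))) \<and>
    (\<forall>I \<subseteq> {1..m}. strict_mono_on I w \<longrightarrow> (\<forall>i\<in>I. w i \<le> v) \<longrightarrow>
      card I \<le> count_le v (first_row (fst (rsk m w))))"
proof (induction m arbitrary: v)
  case 0
  then show ?case by (auto simp: rsk_def first_row_def)
next
  case (Suc m)
  let ?r = "first_row (fst (rsk m w))" and ?x = "w (Suc m)"
  have count: "count_le v (first_row (fst (rsk (Suc m) w))) =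
    (if ?x \<le> v then max (count_le v ?r) (Suc (count_le ?x ?r)) else count_le v ?r)"
    by (simp only: first_row_rsk_Suc count_le_row_insert[OF sorted_first_row_rsk])
  have "\<exists>I \<subseteq> {1..Suc m}. strict_mono_on I w \<and> (\<forall>i\<in>I. w i \<le> v) \<and>
      card I = count_le v (first_row (fst (rsk (Suc m) w)))"
  proof (cases "?x \<le> v \<and> count_le v ?r \<le> Suc (count_le ?x ?r)")
    case True
    obtain I where I: "I \<subseteq> {1..m}" "strict_mono_on I w" "\<forall>i\<in>I. w i \<le> ?x"
      "card I = count_le ?x ?r"
      using Suc[of ?x] by blast
    have lt: "w i < ?x" if "i \<in> I" for i
      using that I(1,3) assms by (force simp: inj_def order.order_iff_strict)
    have "Suc m \<notin> I" "finite I" using I(1) finite_subset by auto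
    then have "card (insert (Suc m) I) = count_le v (first_row (fst (rsk (Suc m) w)))"
      using count True I(4) by simp
    moreover have "strict_mono_on (insert (Suc m) I) w"
      using I(1,2) lt by (fastforce simp: monotone_on_def)
    ultimately show ?thesis
      using I True by (intro exI[of _ "insert (Suc m) I"]) force
  next
    case False
    then have "count_le v (first_row (fst (rsk (Suc m) w))) = count_le v ?r"
      using count by auto
    moreover have "{1..m} \<subseteq> {1..Suc m}" by auto
    ultimately show ?thesis using Suc[of v] by (metis subset_trans)
  qed
  moreover have "card I \<le> count_le v (first_row (fst (rsk (Suc m) w)))"
    if I: "I \<subseteq> {1..Suc m}" "strict_mono_on I w" "\<forall>i\<in>I. w i \<le> v" for I
  proof (cases "Suc m \<in> I")
    case True
    let ?J = "I - {Suc m}"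
    have J: "?J \<subseteq> {1..m}" "strict_mono_on ?J w"
      using I by (auto simp: monotone_on_def le_Suc_eq)
    moreover have "w i \<le> ?x" if "i \<in> ?J" for i
      using that True J(1) strict_mono_onD[OF I(2), of i "Suc m"] by force
    ultimately have "card ?J \<le> count_le ?x ?r" using Suc[of ?x] by blast
    moreover have "card I = Suc (card ?J)"
      using True I(1) finite_subset by (metis card_Suc_Diff1 finite_atLeastAtMost)
    ultimately have "card I \<le> Suc (count_le ?x ?r)" by linarith
    moreover have "?x \<le> v" using True I(3) by blast
    ultimately show ?thesis by (simp only: count if_True max.coboundedI2)
  next
    case False
    then have "I \<subseteq> {1..m}" using I(1) by (auto simp: subset_iff le_Suc_eq)
    then have "card I \<le> count_le v ?r" using Suc[of v] I by blast
    then show ?thesis using count by auto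
  qed
  ultimately show ?case by blast
qed

lemma lambda1_eq_length_first_row: "lambda1 n w = length (first_row (fst (rsk n w)))"
  by (simp add: lambda1_def first_row_def shape_def split: list.splits)

lemma lambda1_longest_increasing:
  assumes "inj w"
  shows "\<exists>I \<subseteq> {1..n}. strict_mono_on I w \<and> card I = lambda1 n w"
    and "I \<subseteq> {1..n} \<Longrightarrow> strict_mono_on I w \<Longrightarrow> card I \<le> lambda1 n w"
proof -
  let ?r = "first_row (fst (rsk n w))"
  \<comment> \<open>A bound so large that it excludes neither an entry of the row nor a value of \<open>w\<close>.\<close>
  define v where "v = Max (insert 0 (set ?r \<union> w ` {1..n}))"
  have v: "y \<le> v" if "y \<in> set ?r \<union> w ` {1..n}" for y
    using that unfolding v_def by (intro Max_ge) auto
  then have count: "count_le v ?r = lambda1 n w"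
    by (simp add: lambda1_eq_length_first_row)
  note Schensted = count_le_first_row_rsk[OF assms, of n v, unfolded count]
  from Schensted show "\<exists>I \<subseteq> {1..n}. strict_mono_on I w \<and> card I = lambda1 n w"
    by blast
  assume I: "I \<subseteq> {1..n}" "strict_mono_on I w"
  then have "\<forall>i\<in>I. w i \<le> v" using v by blast
  with I Schensted show "card I \<le> lambda1 n w" by blast
qed

section \<open>The number of runs and the first row\<close>

theorem theorem3p9:
  fixes n :: nat and w :: "nat \<Rightarrow> nat"
  assumes "n \<ge> 1" and "w permutes {1..n}"
  shows "lambda1 n w + run n w = n"
proof -
  let ?P = "\<lambda>k. \<exists>rs. length rs = k \<and> (\<forall>r\<in>set rs. is_run r) \<and> reduced_word n w (concat rs)"
  have inj: "inj w" using assms(2) permutes_inj by blast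
  obtain I where "I \<subseteq> {1..n}" "strict_mono_on I w" "card I = lambda1 n w"
    using lambda1_longest_increasing(1)[OF inj] by blast
  then obtain rs where rs: "reduced_run_factorization n w rs" "length rs + lambda1 n w \<le> n"
    using ex_reduced_run_factorization[OF assms(2)] by metis
  then have P: "?P (length rs)"
    by (auto simp: reduced_run_factorization_def intro!: reduced_wordI)
  then have "run n w \<le> length rs" unfolding run_def by (rule Least_le)
  moreover have "n \<le> lambda1 n w + run n w"
  proof -
    have "?P (run n w)" unfolding run_def using P by (rule LeastI)
    then obtain qs where qs: "length qs = run n w" "\<forall>r\<in>set qs. is_run r"
      "w = word_prod (concat qs)"
      by (auto simp: reduced_word_def is_word_of_def)
    then obtain J where "J \<subseteq> {1..n}" "strict_mono_on J w" "n \<le> card J + run n w"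
      using increasing_set_of_run_product[OF qs(2), of n] by auto
    then show ?thesis using lambda1_longest_increasing(2)[OF inj, of J n] by simp
  qed
  ultimately show ?thesis using rs(2) by simp
qed

end
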